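(* Let $G$ be a connected non-compact semi-simple real Lie group with Lie algebra $\mathfrak g$, let $H=MAN_-\subset G$ be the identity component of a parabolic subgroup of $G$, let $\mathcal M=G/H$ with base point $\bar e=eH$, and let $\mathfrak g=\mathfrak n_+\oplus(\mathfrak a\oplus\mathfrak m)\oplus\mathfrak n_-$ be the corresponding generalized Bruhat decomposition. (1) If every element of $N_-$ acts trivially on the tangent space $T_{\bar e}\mathcal M$, then $[\mathfrak n_+,\mathfrak n_-]\subseteq\mathfrak a\oplus\mathfrak m$. (2) Conversely, if $[\mathfrak n_+,\mathfrak n_-]\subseteq\mathfrak a\oplus\mathfrak m$, then $\mathfrak n_-$ acts trivially on $T_{\bar e}\mathcal M$.
   Context: Let $\mathfrak g=\mathfrak k\oplus\mathfrak p$ be a Cartan decomposition with Cartan involution $\theta$. Parabolic subgroups are proper. After conjugation, the Lie algebra of the parabolic subgroup is $\mathfrak h=\mathfrak m\oplus\mathfrak a\oplus\mathfrak n_-$ (Langlands decomposition), where $\mathfrak a\subset\mathfrak p$ is abelian, $\mathfrak a\oplus\mathfrak m$ is the centralizer of $\mathfrak a$ in $\mathfrak g$ with $\mathfrak m$ the Killing-orthogonal complement of $\mathfrak a$ in it, and $\mathfrak n_-$ is the nilradical of the parabolic subalgebra; $\mathfrak m$ is $\theta$-stable and reductive. Put $\mathfrak n_+=\theta(\mathfrak n_-)$. The direct sum $\mathfrak g=\mathfrak n_+\oplus(\mathfrak a\oplus\mathfrak m)\oplus\mathfrak n_-$ is the generalized Bruhat decomposition; one has $[\mathfrak a\oplus\mathfrak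 m,\mathfrak n_\pm]\subseteq\mathfrak n_\pm$. $M,A,N_-$ are the connected subgroups of $G$ with Lie algebras $\mathfrak m,\mathfrak a,\mathfrak n_-$. The action of $H$ on $T_{\bar e}\mathcal M=\mathfrak g/\mathfrak h$ is $h\cdot(X+\mathfrak h)=\mathrm{Ad}(h)X+\mathfrak h$, the derivative at $\bar e$ of left translation by $h$; $\mathfrak n_-$ acts by the corresponding infinitesimal action. *)

theory Defs
  imports "HOL-Analysis.Analysis" "HOL-Library.Set_Algebras" "HOL-Algebra.Coset"
begin

section \<open>Smooth maps between open subsets of linear subspaces\<close>

text \<open>
  \<open>S\<close> is meant to be relatively open in the linear subspace \<open>V\<close>. The derivative within \<open>S\<close> is
  then determined on \<open>V\<close> only, so partial derivatives are taken in directions of \<open>V\<close>. Working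
  with subspaces as model spaces allows manifolds of every dimension, including 0, over one fixed type.
\<close>

primrec Ck_on :: "nat \<Rightarrow> 'a::real_normed_vector set \<Rightarrow> 'a set \<Rightarrow> ('a \<Rightarrow> 'b::real_normed_vector) \<Rightarrow> bool"
where
  "Ck_on 0 V S f \<longleftrightarrow> continuous_on S f"
| "Ck_on (Suc k) V S f \<longleftrightarrow>
     (\<forall>x\<in>S. f differentiable (at x within S)) \<and>
     (\<forall>v\<in>V. Ck_on k V S (\<lambda>x. frechet_derivative f (at x within S) v))"

definition smooth_on :: "'a::real_normed_vector set \<Rightarrow> 'a set \<Rightarrow> ('a \<Rightarrow> 'b::real_normed_vector) \<Rightarrow> bool"
where
  "smooth_on V S f \<longleftrightarrow> (\<forall>k. Ck_on k V S f)"

section \<open>Smooth manifolds\<close>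

type_synonym ('a, 'e) chart = "'a set \<times> ('a \<Rightarrow> 'e)"

abbreviation chart_dom :: "('a, 'e) chart \<Rightarrow> 'a set" where "chart_dom \<equiv> fst"
abbreviation chart_map :: "('a, 'e) chart \<Rightarrow> 'a \<Rightarrow> 'e" where "chart_map \<equiv> snd"

definition chart_inv :: "('a, 'e) chart \<Rightarrow> 'e \<Rightarrow> 'a" where
  "chart_inv c = inv_into (chart_dom c) (chart_map c)"

record ('a, 'e) manifold =
  mf_model :: "'e set"
  mf_top :: "'a topology"
  mf_atlas :: "('a, 'e) chart set"

definition is_chart :: "'e::euclidean_space set \<Rightarrow> 'a topology \<Rightarrow> ('a, 'e) chart \<Rightarrow> bool" where
  "is_chart V T c \<longleftrightarrow>
     openin T (chart_dom c) \<and>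
     openin (top_of_set V) (chart_map c ` chart_dom c) \<and>
     homeomorphic_map (subtopology T (chart_dom c)) (top_of_set (chart_map c ` chart_dom c))
       (chart_map c)"

definition charts_compatible :: "'e::euclidean_space set \<Rightarrow> ('a, 'e) chart \<Rightarrow> ('a, 'e) chart \<Rightarrow> bool"
where
  "charts_compatible V c d \<longleftrightarrow>
     smooth_on V (chart_map c ` (chart_dom c \<inter> chart_dom d)) (chart_map d \<circ> chart_inv c)"

definition smooth_manifold :: "('a, 'e::euclidean_space) manifold \<Rightarrow> bool" where
  "smooth_manifold M \<longleftrightarrow>
     subspace (mf_model M) \<and>
     Hausdorff_space (mf_top M) \<and> second_countable (mf_top M) \<and>
     (\<forall>c\<in>mf_atlas M. is_chart (mf_model M) (mf_top M) c) \<and>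
     topspace (mf_top M) = (\<Union>c\<in>mf_atlas M. chart_dom c) \<and>
     (\<forall>c\<in>mf_atlas M. \<forall>d\<in>mf_atlas M. charts_compatible (mf_model M) c d)"

definition chart_overlap :: "('a, 'e) chart \<Rightarrow> ('b, 'f) chart \<Rightarrow> ('a \<Rightarrow> 'b) \<Rightarrow> 'e set" where
  "chart_overlap c d f = chart_map c ` (chart_dom c \<inter> f -` chart_dom d)"

definition smooth_map ::
  "('a, 'e::euclidean_space) manifold \<Rightarrow> ('b, 'f::euclidean_space) manifold \<Rightarrow> ('a \<Rightarrow> 'b) \<Rightarrow> bool"
where
  "smooth_map M M' f \<longleftrightarrow>
     continuous_map (mf_top M) (mf_top M') f \<and>
     (\<forall>c\<in>mf_atlas M. \<forall>d\<in>mf_atlas M'.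
        smooth_on (mf_model M) (chart_overlap c d f) (chart_map d \<circ> f \<circ> chart_inv c))"

text \<open>The differential of \<open>f\<close> at the point \<open>p\<close>, expressed in the charts \<open>c\<close> and \<open>d\<close>.\<close>

definition chart_differential ::
  "('a, 'e::euclidean_space) chart \<Rightarrow> ('b, 'f::euclidean_space) chart \<Rightarrow> ('a \<Rightarrow> 'b) \<Rightarrow> 'a \<Rightarrow> 'e \<Rightarrow> 'f"
where
  "chart_differential c d f p =
     frechet_derivative (chart_map d \<circ> f \<circ> chart_inv c)
       (at (chart_map c p) within chart_overlap c d f)"

definition smooth_immersion ::
  "('a, 'e::euclidean_space) manifold \<Rightarrow> ('b, 'f::euclidean_space) manifold \<Rightarrow> ('a \<Rightarrow> 'b) \<Rightarrow> bool"
where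
  "smooth_immersion M M' f \<longleftrightarrow>
     smooth_map M M' f \<and>
     (\<forall>c\<in>mf_atlas M. \<forall>d\<in>mf_atlas M'. \<forall>p \<in> chart_dom c \<inter> f -` chart_dom d.
        inj_on (chart_differential c d f p) (mf_model M))"

definition prod_manifold ::
  "('a, 'e::euclidean_space) manifold \<Rightarrow> ('b, 'f::euclidean_space) manifold \<Rightarrow>
   ('a \<times> 'b, 'e \<times> 'f) manifold"
where
  "prod_manifold M M' =
     \<lparr> mf_model = mf_model M \<times> mf_model M',
       mf_top = prod_topology (mf_top M) (mf_top M'),
       mf_atlas = {(chart_dom c \<times> chart_dom d, map_prod (chart_map c) (chart_map d)) | c d.
                     c \<in> mf_atlas M \<and> d \<in> mf_atlas M'} \<rparr>"

section \<open>Lie groups and their Lie algebras\<close>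

definition lie_group :: "('a, 'm) monoid_scheme \<Rightarrow> ('a, 'e::euclidean_space) manifold \<Rightarrow> bool" where
  "lie_group G M \<longleftrightarrow>
     group G \<and> smooth_manifold M \<and> topspace (mf_top M) = carrier G \<and>
     smooth_map (prod_manifold M M) M (\<lambda>(x, y). x \<otimes>\<^bsub>G\<^esub> y) \<and>
     smooth_map M M (\<lambda>x. inv\<^bsub>G\<^esub> x)"

text \<open>
  For a Lie group modelled on the whole space \<open>'e\<close> and a chart \<open>c\<close> around the unit element, the
  tangent space at the unit element is identified with \<open>'e\<close> through the differential of \<open>c\<close>.
  In these coordinates \<open>left_field G c X\<close> is the left-invariant vector field with value \<open>X\<close> at
  the unit element, and \<open>lie_br G c\<close> is the Lie bracket of left-invariant vector fields,
  evaluated at the unit element.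
\<close>

definition unit_chart :: "('a, 'm) monoid_scheme \<Rightarrow> ('a, 'e::euclidean_space) manifold \<Rightarrow> ('a, 'e) chart \<Rightarrow> bool"
where
  "unit_chart G M c \<longleftrightarrow> c \<in> mf_atlas M \<and> \<one>\<^bsub>G\<^esub> \<in> chart_dom c"

definition left_field ::
  "('a, 'm) monoid_scheme \<Rightarrow> ('a, 'e::euclidean_space) chart \<Rightarrow> 'e \<Rightarrow> 'e \<Rightarrow> 'e"
where
  "left_field G c X x =
     frechet_derivative (\<lambda>y. chart_map c (chart_inv c x \<otimes>\<^bsub>G\<^esub> chart_inv c y))
       (at (chart_map c \<one>\<^bsub>G\<^esub>)) X"

definition lie_br ::
  "('a, 'm) monoid_scheme \<Rightarrow> ('a, 'e::euclidean_space) chart \<Rightarrow> 'e \<Rightarrow> 'e \<Rightarrow> 'e"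
where
  "lie_br G c X Y =
     frechet_derivative (left_field G c Y) (at (chart_map c \<one>\<^bsub>G\<^esub>)) X -
     frechet_derivative (left_field G c X) (at (chart_map c \<one>\<^bsub>G\<^esub>)) Y"

definition Ad ::
  "('a, 'm) monoid_scheme \<Rightarrow> ('a, 'e::euclidean_space) chart \<Rightarrow> 'a \<Rightarrow> 'e \<Rightarrow> 'e"
where
  "Ad G c g X =
     frechet_derivative (\<lambda>y. chart_map c (g \<otimes>\<^bsub>G\<^esub> chart_inv c y \<otimes>\<^bsub>G\<^esub> inv\<^bsub>G\<^esub> g))
       (at (chart_map c \<one>\<^bsub>G\<^esub>)) X"

text \<open>The infinitesimal adjoint action: the differential of \<open>g \<mapsto> Ad(g) X\<close> at the unit element,
  in direction \<open>Y\<close>.\<close>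

definition Ad_infinitesimal ::
  "('a, 'm) monoid_scheme \<Rightarrow> ('a, 'e::euclidean_space) chart \<Rightarrow> 'e \<Rightarrow> 'e \<Rightarrow> 'e"
where
  "Ad_infinitesimal G c Y X =
     frechet_derivative (\<lambda>x. Ad G c (chart_inv c x) X) (at (chart_map c \<one>\<^bsub>G\<^esub>)) Y"

text \<open>
  \<open>N\<close> is the connected (immersed) Lie subgroup with Lie algebra \<open>s\<close>. Its topology may be finer
  than the one induced from \<open>G\<close>.
\<close>

definition connected_lie_subgroup ::
  "('a, 'm) monoid_scheme \<Rightarrow> ('a, 'e::euclidean_space) manifold \<Rightarrow> ('a, 'e) chart \<Rightarrow>
   'a set \<Rightarrow> 'e set \<Rightarrow> bool"
where
  "connected_lie_subgroup G M c N s \<longleftrightarrow>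
     subgroup N G \<and>
     (\<exists>M' :: ('a, 'e) manifold.
        lie_group (G\<lparr>carrier := N\<rparr>) M' \<and> connected_space (mf_top M') \<and>
        smooth_immersion M' M (\<lambda>x. x) \<and>
        (\<forall>d. unit_chart G M' d \<longrightarrow>
           chart_differential d c (\<lambda>x. x) \<one>\<^bsub>G\<^esub> ` mf_model M' = s))"

section \<open>Lie algebras\<close>

text \<open>
  Below, \<open>br\<close> is the bracket of a Lie algebra on a whole type; subalgebras and ideals are subsets.
\<close>

definition bracket_span :: "('v \<Rightarrow> 'v \<Rightarrow> 'v::real_vector) \<Rightarrow> 'v set \<Rightarrow> 'v set \<Rightarrow> 'v set" where
  "bracket_span br S T = span {br x y | x y. x \<in> S \<and> y \<in> T}"

definition lie_subalgebra :: "('v \<Rightarrow> 'v \<Rightarrow> 'v::real_vector) \<Rightarrow> 'v set \<Rightarrow> bool" where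
  "lie_subalgebra br S \<longleftrightarrow> subspace S \<and> (\<forall>x\<in>S. \<forall>y\<in>S. br x y \<in> S)"

definition lie_ideal :: "('v \<Rightarrow> 'v \<Rightarrow> 'v::real_vector) \<Rightarrow> 'v set \<Rightarrow> 'v set \<Rightarrow> bool" where
  "lie_ideal br S I \<longleftrightarrow> subspace I \<and> I \<subseteq> S \<and> (\<forall>x\<in>S. \<forall>y\<in>I. br x y \<in> I)"

definition lie_solvable :: "('v \<Rightarrow> 'v \<Rightarrow> 'v::real_vector) \<Rightarrow> 'v set \<Rightarrow> bool" where
  "lie_solvable br S \<longleftrightarrow> (\<exists>k. ((\<lambda>T. bracket_span br T T) ^^ k) S = {0})"

definition lie_nilpotent :: "('v \<Rightarrow> 'v \<Rightarrow> 'v::real_vector) \<Rightarrow> 'v set \<Rightarrow> bool" where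
  "lie_nilpotent br S \<longleftrightarrow> (\<exists>k. (bracket_span br S ^^ k) S = {0})"

definition lie_semisimple :: "('v \<Rightarrow> 'v \<Rightarrow> 'v::real_vector) \<Rightarrow> bool" where
  "lie_semisimple br \<longleftrightarrow> (\<forall>I. lie_ideal br UNIV I \<and> lie_solvable br I \<longrightarrow> I = {0})"

definition is_nilradical :: "('v \<Rightarrow> 'v \<Rightarrow> 'v::real_vector) \<Rightarrow> 'v set \<Rightarrow> 'v set \<Rightarrow> bool" where
  "is_nilradical br q n \<longleftrightarrow>
     lie_ideal br q n \<and> lie_nilpotent br n \<and>
     (\<forall>I. lie_ideal br q I \<and> lie_nilpotent br I \<longrightarrow> I \<subseteq> n)"

definition centralizer :: "('v \<Rightarrow> 'v \<Rightarrow> 'v::real_vector) \<Rightarrow> 'v set \<Rightarrow> 'v set" where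
  "centralizer br S = {x. \<forall>y\<in>S. br x y = 0}"

definition killing :: "('e \<Rightarrow> 'e \<Rightarrow> 'e::euclidean_space) \<Rightarrow> 'e \<Rightarrow> 'e \<Rightarrow> real" where
  "killing br X Y = (\<Sum>b\<in>Basis. br X (br Y b) \<bullet> b)"

definition cartan_involution :: "('e \<Rightarrow> 'e \<Rightarrow> 'e::euclidean_space) \<Rightarrow> ('e \<Rightarrow> 'e) \<Rightarrow> bool" where
  "cartan_involution br \<theta> \<longleftrightarrow>
     linear \<theta> \<and> (\<forall>X Y. \<theta> (br X Y) = br (\<theta> X) (\<theta> Y)) \<and> (\<forall>X. \<theta> (\<theta> X) = X) \<and>
     (\<forall>X. X \<noteq> 0 \<longrightarrow> - killing br X (\<theta> X) > 0)"

text \<open>The part \<open>p\<close> of the Cartan decomposition \<open>g = k \<oplus> p\<close>.\<close>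

definition cartan_p :: "('e::real_vector \<Rightarrow> 'e) \<Rightarrow> 'e set" where
  "cartan_p \<theta> = {X. \<theta> X = - X}"

definition direct_sum3 :: "'v::real_vector set \<Rightarrow> 'v set \<Rightarrow> 'v set \<Rightarrow> 'v set \<Rightarrow> bool" where
  "direct_sum3 S A B C \<longleftrightarrow>
     subspace A \<and> subspace B \<and> subspace C \<and> S = A + B + C \<and>
     (\<forall>x\<in>A. \<forall>y\<in>B. \<forall>z\<in>C. x + y + z = 0 \<longrightarrow> x = 0 \<and> y = 0 \<and> z = 0)"

section \<open>Parabolic subalgebras and subgroups\<close>

text \<open>
  The pair \<open>(x, y)\<close> represents \<open>x + \<i> y\<close> in the complexification. The real span in
  \<open>bracket_span\<close> of brackets of complex subspaces is already a complex subspace, so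
  \<open>lie_solvable\<close> can be used for complex subalgebras.
\<close>

definition complexified_br :: "('v \<Rightarrow> 'v \<Rightarrow> 'v::real_vector) \<Rightarrow> 'v \<times> 'v \<Rightarrow> 'v \<times> 'v \<Rightarrow> 'v \<times> 'v" where
  "complexified_br br z w =
     (br (fst z) (fst w) - br (snd z) (snd w), br (fst z) (snd w) + br (snd z) (fst w))"

definition complex_subalgebra :: "('v \<Rightarrow> 'v \<Rightarrow> 'v::real_vector) \<Rightarrow> ('v \<times> 'v) set \<Rightarrow> bool" where
  "complex_subalgebra br b \<longleftrightarrow>
     lie_subalgebra (complexified_br br) b \<and> (\<forall>(x, y)\<in>b. (- y, x) \<in> b)"

definition borel_subalgebra :: "('v \<Rightarrow> 'v \<Rightarrow> 'v::real_vector) \<Rightarrow> ('v \<times> 'v) set \<Rightarrow> bool" where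
  "borel_subalgebra br b \<longleftrightarrow>
     complex_subalgebra br b \<and> lie_solvable (complexified_br br) b \<and>
     (\<forall>b'. complex_subalgebra br b' \<and> lie_solvable (complexified_br br) b' \<and> b \<subseteq> b' \<longrightarrow> b' = b)"

definition proper_parabolic_subalgebra :: "('v \<Rightarrow> 'v \<Rightarrow> 'v::real_vector) \<Rightarrow> 'v set \<Rightarrow> bool" where
  "proper_parabolic_subalgebra br q \<longleftrightarrow>
     lie_subalgebra br q \<and> q \<noteq> UNIV \<and> (\<exists>b. borel_subalgebra br b \<and> b \<subseteq> q \<times> q)"

text \<open>The parabolic subgroup belonging to a parabolic subalgebra \<open>q\<close> is the normalizer of \<open>q\<close>.\<close>

definition parabolic_subgroup ::
  "('a, 'm) monoid_scheme \<Rightarrow> ('a, 'e::euclidean_space) chart \<Rightarrow> 'e set \<Rightarrow> 'a set"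
where
  "parabolic_subgroup G c q = {g \<in> carrier G. Ad G c g ` q = q}"

definition langlands_decomposition ::
  "('e \<Rightarrow> 'e \<Rightarrow> 'e::euclidean_space) \<Rightarrow> ('e \<Rightarrow> 'e) \<Rightarrow> 'e set \<Rightarrow> 'e set \<Rightarrow> 'e set \<Rightarrow> 'e set \<Rightarrow> bool"
where
  "langlands_decomposition br \<theta> q m a n \<longleftrightarrow>
     direct_sum3 q m a n \<and>
     a \<subseteq> cartan_p \<theta> \<and> (\<forall>x\<in>a. \<forall>y\<in>a. br x y = 0) \<and>
     m = {x \<in> centralizer br a. \<forall>y\<in>a. killing br x y = 0} \<and>
     a + m = centralizer br a \<and>
     is_nilradical br q n"

definition identity_component ::
  "('a, 'm) monoid_scheme \<Rightarrow> ('a, 'e) manifold \<Rightarrow> 'a set \<Rightarrow> 'a set"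
where
  "identity_component G M P = connected_component_of_set (subtopology (mf_top M) P) \<one>\<^bsub>G\<^esub>"

section \<open>The isotropy action on the tangent space of \<open>G/H\<close>\<close>

text \<open>
  The tangent space of \<open>G/H\<close> at the base point is \<open>g/h\<close>, the set of cosets \<open>X + h\<close>. The map
  \<open>quot_map h f\<close> sends \<open>X + h\<close> to \<open>f X + h\<close> whenever the linear map \<open>f\<close> preserves \<open>h\<close>.
\<close>

definition tangent_quotient :: "'v::real_vector set \<Rightarrow> 'v set set" where
  "tangent_quotient h = range (\<lambda>X. X +o h)"

definition quot_map :: "'v::real_vector set \<Rightarrow> ('v \<Rightarrow> 'v) \<Rightarrow> 'v set \<Rightarrow> 'v set" where
  "quot_map h f C = (\<Union>X\<in>C. f X +o h)"

definition group_acts_trivially ::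
  "('a, 'm) monoid_scheme \<Rightarrow> ('a, 'e::euclidean_space) chart \<Rightarrow> 'e set \<Rightarrow> 'a set \<Rightarrow> bool"
where
  "group_acts_trivially G c h N \<longleftrightarrow>
     (\<forall>g\<in>N. \<forall>C\<in>tangent_quotient h. quot_map h (Ad G c g) C = C)"

text \<open>The zero vector of \<open>g/h\<close> is the coset \<open>h\<close>.\<close>

definition algebra_acts_trivially ::
  "('a, 'm) monoid_scheme \<Rightarrow> ('a, 'e::euclidean_space) chart \<Rightarrow> 'e set \<Rightarrow> 'e set \<Rightarrow> bool"
where
  "algebra_acts_trivially G c h n \<longleftrightarrow>
     (\<forall>Y\<in>n. \<forall>C\<in>tangent_quotient h. quot_map h (Ad_infinitesimal G c Y) C = h)"

end

(*
  In a chart around the unit element, Ad(g) X = d/dy (g y g^-1) can be written with the first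
  derivatives of the multiplication in the chart. Differentiating in g and using the symmetry of
  second derivatives gives d/dg Ad(g) X in direction Y = [Y, X].

  If N_- acts trivially on g/h, then Ad(g) X - X lies in h for g in N_-, and differentiating along
  curves in N_- yields [n_-, g] <= h. Since theta exchanges n_+ and n_-, the bracket [n_+, n_-] lies
  in the intersection of h and theta(h), which is a + m because the centralizer of a is
  theta-stable. The converse follows from g = n_+ + h and [n_+, n_-] <= h.
*)
theory Submission
  imports Defs
begin

section \<open>Symmetry of second derivatives and a product rule\<close>

text \<open>The mixed second difference is an increment in direction \<open>v\<close> of the
  difference of \<open>f\<close> along two parallel segments shifted by \<open>t\<close> times
  \<open>w\<close>. The mean value theorem turns it into \<open>t\<close> times a difference of two
  values of \<open>D _ v\<close>, and differentiability of \<open>D _ v\<close> at \<open>x\<close>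
  evaluates that difference up to an error of order \<open>\<epsilon> * t\<close>.\<close>

lemma second_difference:
  fixes f :: "'a::real_normed_vector \<Rightarrow> real"
  assumes "open S" "x \<in> S"
    and f: "\<And>z. z \<in> S \<Longrightarrow> (f has_derivative D z) (at z)"
    and D: "((\<lambda>z. D z v) has_derivative E) (at x)"
    and "0 < \<epsilon>"
  shows "\<exists>\<delta>>0. \<forall>t. 0 < t \<and> t < \<delta> \<longrightarrow>
    \<bar>f (x + t *\<^sub>R v + t *\<^sub>R w) - f (x + t *\<^sub>R v) - f (x + t *\<^sub>R w) + f x - t\<^sup>2 * E w\<bar> \<le> \<epsilon> * t\<^sup>2"
proof -
  obtain r where r: "r > 0" "ball x r \<subseteq> S"
    using assms(1,2) by (meson openE)
  \<comment> \<open>\<open>t * K\<close> bounds the norm of every combination of \<open>v\<close>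
    and \<open>w\<close> with coefficients in [0, t]. The summand 1 makes \<open>K\<close> positive
    even if both vectors vanish, so that it can be divided by.\<close>
  define K where "K = norm v + norm w + 1"
  have K: "K > 0" by (simp add: K_def add_nonneg_pos)
  interpret E: bounded_linear E using D by (rule has_derivative_bounded_linear)
  have "\<epsilon> / (2 * K) > 0" using K \<open>0 < \<epsilon>\<close> by simp
  then obtain d where d: "d > 0"
    "\<And>y. norm (y - x) < d \<Longrightarrow> \<bar>D y v - D x v - E (y - x)\<bar> \<le> \<epsilon> / (2 * K) * norm (y - x)"
    using D unfolding has_derivative_at_alt real_norm_def by blast
  show ?thesis
  proof (intro exI conjI allI impI)
    \<comment> \<open>For \<open>t\<close> below this bound the whole parallelogram lies in
      \<open>ball x r\<close>, hence in \<open>S\<close>, and within distance \<open>d\<close> of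
      \<open>x\<close>, where the first-order expansion of \<open>D _ v\<close> holds.\<close>
    show "min d r / K > 0" using d r K by simp
  next
    fix t assume t: "0 < t \<and> t < min d r / K"
    have tK: "t * K < d" "t * K < r"
      using t K by (auto simp: field_simps)
    have nrm: "norm (s *\<^sub>R v + u *\<^sub>R w) \<le> t * K" if "0 \<le> s" "s \<le> t" "0 \<le> u" "u \<le> t" for s u
    proof -
      have "norm (s *\<^sub>R v + u *\<^sub>R w) \<le> s * norm v + u * norm w"
        using norm_triangle_ineq[of "s *\<^sub>R v" "u *\<^sub>R w"] that by simp
      also have "\<dots> \<le> t * norm v + t * norm w"
        using that by (intro add_mono mult_right_mono) auto
      also have "\<dots> \<le> t * K" using t by (simp add: K_def algebra_simps)
      finally show ?thesis .
    qed
    have inS: "x + s *\<^sub>R v + u *\<^sub>R w \<in> S" if "0 \<le> s" "s \<le> t" "0 \<le> u" "u \<le> t" for s u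
    proof -
      have "norm (s *\<^sub>R v + u *\<^sub>R w) < r" using nrm[OF that] tK by linarith
      then have "x + s *\<^sub>R v + u *\<^sub>R w \<in> ball x r"
        by (metis add.assoc add_diff_cancel_left' dist_commute dist_norm mem_ball)
      then show ?thesis using r by blast
    qed
    have est: "\<bar>D (x + s *\<^sub>R v + u *\<^sub>R w) v - D x v - E (s *\<^sub>R v + u *\<^sub>R w)\<bar> \<le> \<epsilon> / 2 * t"
      if "0 \<le> s" "s \<le> t" "0 \<le> u" "u \<le> t" for s u
    proof -
      have eq: "x + s *\<^sub>R v + u *\<^sub>R w - x = s *\<^sub>R v + u *\<^sub>R w" by simp
      have "\<bar>D (x + s *\<^sub>R v + u *\<^sub>R w) v - D x v - E (s *\<^sub>R v + u *\<^sub>R w)\<bar>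
          \<le> \<epsilon> / (2 * K) * norm (s *\<^sub>R v + u *\<^sub>R w)"
        using d(2)[of "x + s *\<^sub>R v + u *\<^sub>R w"] nrm[OF that] tK unfolding eq by linarith
      also have "\<dots> \<le> \<epsilon> / (2 * K) * (t * K)"
        using nrm[OF that] K \<open>0 < \<epsilon>\<close> by (intro mult_left_mono) auto
      also have "\<dots> = \<epsilon> / 2 * t" using K by (simp add: field_simps)
      finally show ?thesis .
    qed
    \<comment> \<open>The second difference is \<open>\<phi> t - \<phi> 0\<close>. The zero multiple
      of \<open>w\<close> is written out so that \<open>deriv\<close> and \<open>est\<close> apply
      to both terms, with \<open>u = t\<close> and \<open>u = 0\<close>.\<close>
    define \<phi> where "\<phi> s = f (x + s *\<^sub>R v + t *\<^sub>R w) - f (x + s *\<^sub>R v + 0 *\<^sub>R w)" for s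
    define \<phi>' where "\<phi>' s = D (x + s *\<^sub>R v + t *\<^sub>R w) v - D (x + s *\<^sub>R v + 0 *\<^sub>R w) v" for s
    have deriv: "DERIV (\<lambda>s. f (x + s *\<^sub>R v + u *\<^sub>R w)) s :> D (x + s *\<^sub>R v + u *\<^sub>R w) v"
      if "0 \<le> s" "s \<le> t" "0 \<le> u" "u \<le> t" for s u
    proof -
      have 1: "((\<lambda>s. x + s *\<^sub>R v + u *\<^sub>R w) has_derivative (\<lambda>h. h *\<^sub>R v)) (at s)"
        by (auto intro!: derivative_eq_intros)
      have 2: "(f has_derivative D (x + s *\<^sub>R v + u *\<^sub>R w)) (at (x + s *\<^sub>R v + u *\<^sub>R w))"
        using f inS[OF that] by blast
      interpret L: bounded_linear "D (x + s *\<^sub>R v + u *\<^sub>R w)"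
        using 2 by (rule has_derivative_bounded_linear)
      show ?thesis
        unfolding has_field_derivative_def
        using diff_chain_at[OF 1 2] by (simp add: o_def L.scaleR mult_commute_abs)
    qed
    have "DERIV \<phi> s :> \<phi>' s" if "0 \<le> s" "s \<le> t" for s
      unfolding \<phi>_def \<phi>'_def by (intro DERIV_diff deriv) (use that t in auto)
    then obtain \<xi> where \<xi>: "0 < \<xi>" "\<xi> < t" "\<phi> t - \<phi> 0 = (t - 0) * \<phi>' \<xi>"
      using MVT2[of 0 t \<phi> \<phi>'] t by blast
    \<comment> \<open>Both points are expanded around \<open>x\<close>. The contributions of
      \<open>\<xi>\<close> and of \<open>D x v\<close> cancel by linearity of \<open>E\<close>,
      leaving \<open>t * E w\<close> and two errors of at most
      \<open>\<epsilon> / 2 * t\<close>.\<close>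
    have "\<bar>\<phi>' \<xi> - t * E w\<bar> \<le> \<epsilon> * t"
    proof -
      have "\<phi>' \<xi> - t * E w =
          (D (x + \<xi> *\<^sub>R v + t *\<^sub>R w) v - D x v - E (\<xi> *\<^sub>R v + t *\<^sub>R w)) -
          (D (x + \<xi> *\<^sub>R v + 0 *\<^sub>R w) v - D x v - E (\<xi> *\<^sub>R v + 0 *\<^sub>R w))"
        by (simp add: \<phi>'_def E.add E.scaleR)
      then show ?thesis
        using est[of \<xi> t] est[of \<xi> 0] \<xi>(1,2) t by linarith
    qed
    then have "t * \<bar>\<phi>' \<xi> - t * E w\<bar> \<le> t * (\<epsilon> * t)"
      using t by (intro mult_left_mono) auto
    moreover have "\<phi> t - \<phi> 0 - t\<^sup>2 * E w = t * (\<phi>' \<xi> - t * E w)"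
      unfolding \<xi>(3) by (simp add: power2_eq_square algebra_simps)
    then have "\<bar>\<phi> t - \<phi> 0 - t\<^sup>2 * E w\<bar> = t * \<bar>\<phi>' \<xi> - t * E w\<bar>"
      using t by (simp add: abs_mult)
    moreover have "\<phi> t - \<phi> 0 = f (x + t *\<^sub>R v + t *\<^sub>R w) - f (x + t *\<^sub>R v) - f (x + t *\<^sub>R w) + f x"
      by (simp add: \<phi>_def)
    ultimately show "\<bar>f (x + t *\<^sub>R v + t *\<^sub>R w) - f (x + t *\<^sub>R v) - f (x + t *\<^sub>R w) + f x - t\<^sup>2 * E w\<bar> \<le> \<epsilon> * t\<^sup>2"
      by (simp add: power2_eq_square algebra_simps)
  qed
qed

text \<open>The second difference does not change when \<open>v\<close> and \<open>w\<close> are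
  exchanged, so it is approximated by both \<open>t\<^sup>2 * E w\<close> and
  \<open>t\<^sup>2 * F v\<close>. With \<open>\<epsilon>\<close> a third of their supposed gap, the
  two errors are together too small to bridge it.\<close>

lemma symmetric_second_derivative_real:
  fixes f :: "'a::real_normed_vector \<Rightarrow> real"
  assumes "open S" "x \<in> S"
    and f: "\<And>z. z \<in> S \<Longrightarrow> (f has_derivative D z) (at z)"
    and v: "((\<lambda>z. D z v) has_derivative E) (at x)"
    and w: "((\<lambda>z. D z w) has_derivative F) (at x)"
  shows "E w = F v"
proof (rule ccontr)
  assume "E w \<noteq> F v"
  define \<epsilon> where "\<epsilon> = \<bar>E w - F v\<bar> / 3"
  have \<epsilon>: "\<epsilon> > 0" using \<open>E w \<noteq> F v\<close> by (simp add: \<epsilon>_def)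
  obtain d where d: "d > 0"
    and vw: "\<And>t. 0 < t \<Longrightarrow> t < d \<Longrightarrow>
    \<bar>f (x + t *\<^sub>R v + t *\<^sub>R w) - f (x + t *\<^sub>R v) - f (x + t *\<^sub>R w) + f x - t\<^sup>2 * E w\<bar> \<le> \<epsilon> * t\<^sup>2"
    using second_difference[OF assms(1,2) f v \<epsilon>] by blast
  obtain e where e: "e > 0"
    and wv: "\<And>t. 0 < t \<Longrightarrow> t < e \<Longrightarrow>
    \<bar>f (x + t *\<^sub>R w + t *\<^sub>R v) - f (x + t *\<^sub>R w) - f (x + t *\<^sub>R v) + f x - t\<^sup>2 * F v\<bar> \<le> \<epsilon> * t\<^sup>2"
    using second_difference[OF assms(1,2) f w \<epsilon>] by blast
  define t where "t = min d e / 2"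
  have t: "0 < t" "t < d" "t < e" using d e by (auto simp: t_def)
  have eq: "x + t *\<^sub>R w + t *\<^sub>R v = x + t *\<^sub>R v + t *\<^sub>R w" by (simp add: algebra_simps)
  have "\<bar>t\<^sup>2 * E w - t\<^sup>2 * F v\<bar> \<le> 2 * (\<epsilon> * t\<^sup>2)"
    using vw[OF t(1,2)] wv[OF t(1,3)] unfolding eq by linarith
  moreover have "\<bar>t\<^sup>2 * E w - t\<^sup>2 * F v\<bar> = t\<^sup>2 * (3 * \<epsilon>)"
    by (simp add: \<epsilon>_def abs_mult flip: right_diff_distrib)
  ultimately have "t\<^sup>2 * \<epsilon> \<le> 0" by (simp add: mult.commute)
  then show False using t \<epsilon> by (simp add: mult_le_0_iff)
qed

text \<open>The real case rests on the mean value theorem, which has no vector-valued form, so the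
  components along \<open>Basis\<close> are treated one at a time.\<close>

lemma symmetric_second_derivative:
  fixes f :: "'a::real_normed_vector \<Rightarrow> 'b::euclidean_space"
  assumes "open S" "x \<in> S"
    and f: "\<And>z. z \<in> S \<Longrightarrow> (f has_derivative D z) (at z)"
    and v: "((\<lambda>z. D z v) has_derivative E) (at x)"
    and w: "((\<lambda>z. D z w) has_derivative F) (at x)"
  shows "E w = F v"
proof (rule euclidean_eqI)
  fix b :: 'b
  show "E w \<bullet> b = F v \<bullet> b"
    by (rule symmetric_second_derivative_real[OF assms(1,2),
          of "\<lambda>z. f z \<bullet> b" "\<lambda>z v. D z v \<bullet> b"])
      (use f v w in \<open>auto intro!: has_derivative_inner_left\<close>)
qed

text \<open>A product rule for a linear map and its argument that vary together. Differentiability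
  of the family is given for each fixed vector only, so the moving argument is expanded in the
  finite \<open>Basis\<close>, which leaves scalar coefficients times maps applied to fixed
  vectors.\<close>

lemma has_derivative_family_apply:
  fixes D :: "'a::real_normed_vector \<Rightarrow> 'c::euclidean_space \<Rightarrow> 'b::real_normed_vector"
    and \<alpha> :: "'d::real_normed_vector \<Rightarrow> 'a"
  assumes "open S" "\<alpha> t \<in> S"
    and lin: "\<And>z. z \<in> S \<Longrightarrow> linear (D z)"
    and D: "\<And>v. ((\<lambda>z. D z v) has_derivative E v) (at (\<alpha> t))"
    and a: "(\<alpha> has_derivative \<alpha>') (at t)"
    and b: "(\<beta> has_derivative \<beta>') (at t)"
  shows "((\<lambda>s. D (\<alpha> s) (\<beta> s)) has_derivative (\<lambda>h. E (\<beta> t) (\<alpha>' h) + D (\<alpha> t) (\<beta>' h))) (at t)"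
proof -
  have expand: "D z v = (\<Sum>i\<in>Basis. (v \<bullet> i) *\<^sub>R D z i)" if "z \<in> S" for z v
  proof -
    have "D z (\<Sum>i\<in>Basis. (v \<bullet> i) *\<^sub>R i) = (\<Sum>i\<in>Basis. (v \<bullet> i) *\<^sub>R D z i)"
      using lin[OF that] by (simp add: linear_sum linear_scale)
    then show ?thesis by (simp add: euclidean_representation)
  qed
  have "((\<lambda>z. \<Sum>i\<in>Basis. (v \<bullet> i) *\<^sub>R D z i) has_derivative
      (\<lambda>h. \<Sum>i\<in>Basis. (v \<bullet> i) *\<^sub>R E i h)) (at (\<alpha> t))" for v
    by (auto intro!: derivative_eq_intros D)
  then have "((\<lambda>z. D z v) has_derivative (\<lambda>h. \<Sum>i\<in>Basis. (v \<bullet> i) *\<^sub>R E i h)) (at (\<alpha> t))" for v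
    by (rule has_derivative_transform_within_open[OF _ assms(1,2)]) (rule expand[symmetric])
  \<comment> \<open>The derivatives \<open>E v\<close> are given for each \<open>v\<close>
    separately; uniqueness of derivatives forces them to depend linearly on
    \<open>v\<close>.\<close>
  then have E: "E v = (\<lambda>h. \<Sum>i\<in>Basis. (v \<bullet> i) *\<^sub>R E i h)" for v
    using D has_derivative_unique by blast
  have "isCont \<alpha> t" using a has_derivative_continuous by blast
  then obtain T where T: "open T" "t \<in> T" "\<And>s. s \<in> T \<Longrightarrow> \<alpha> s \<in> S"
    using assms(1,2) continuous_at_open by metis
  have "((\<lambda>s. \<Sum>i\<in>Basis. (\<beta> s \<bullet> i) *\<^sub>R D (\<alpha> s) i) has_derivative
     (\<lambda>h. \<Sum>i\<in>Basis. (\<beta> t \<bullet> i) *\<^sub>R E i (\<alpha>' h) + (\<beta>' h \<bullet> i) *\<^sub>R D (\<alpha> t) i)) (at t)"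
    using diff_chain_at[OF a D, unfolded o_def] b by (auto intro!: derivative_eq_intros)
  then have "((\<lambda>s. \<Sum>i\<in>Basis. (\<beta> s \<bullet> i) *\<^sub>R D (\<alpha> s) i) has_derivative
     (\<lambda>h. E (\<beta> t) (\<alpha>' h) + D (\<alpha> t) (\<beta>' h))) (at t)"
    by (subst E) (simp add: expand[OF assms(2), of "\<beta>' _"] sum.distrib)
  then show ?thesis
    by (rule has_derivative_transform_within_open[OF _ T(1,2)]) (rule expand[OF T(3), symmetric])
qed

section \<open>Charts, overlaps and product charts\<close>

lemma is_chart_inj: "is_chart V T c \<Longrightarrow> inj_on (chart_map c) (chart_dom c)"
  unfolding is_chart_def
  by (metis homeomorphic_imp_injective_map openin_subset topspace_subtopology_subset)

lemma is_chart_inv_map: "is_chart V T c \<Longrightarrow> g \<in> chart_dom c \<Longrightarrow> chart_inv c (chart_map c g) = g"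
  by (simp add: chart_inv_def is_chart_inj)

lemma chart_map_inv:
  "x \<in> chart_map c ` chart_dom c \<Longrightarrow> chart_map c (chart_inv c x) = x"
  "x \<in> chart_map c ` chart_dom c \<Longrightarrow> chart_inv c x \<in> chart_dom c"
  by (simp_all add: chart_inv_def f_inv_into_f inv_into_into)

text \<open>The preimage of the second chart domain is open by continuity. The first chart is a
  homeomorphism onto its image, which is itself open in \<open>V\<close>, so the overlap is open in
  \<open>V\<close> by transitivity.\<close>

lemma openin_chart_overlap:
  assumes c: "is_chart V T c" and d: "openin T' (chart_dom d)" and f: "continuous_map T T' f"
  shows "openin (top_of_set V) (chart_overlap c d f)"
proof -
  have "openin T (chart_dom c)" "homeomorphic_map (subtopology T (chart_dom c))
      (top_of_set (chart_map c ` chart_dom c)) (chart_map c)"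
    and V: "openin (top_of_set V) (chart_map c ` chart_dom c)"
    using c by (auto simp: is_chart_def)
  have eq: "chart_dom c \<inter> f -` chart_dom d = {x \<in> chart_dom c. f x \<in> chart_dom d}" by auto
  have "openin T (chart_dom c \<inter> f -` chart_dom d)"
    unfolding eq using openin_continuous_map_preimage_gen f d \<open>openin T (chart_dom c)\<close> by blast
  then have "openin (subtopology T (chart_dom c)) (chart_dom c \<inter> f -` chart_dom d)"
    using \<open>openin T (chart_dom c)\<close> by (simp add: openin_open_subtopology)
  then have "openin (top_of_set (chart_map c ` chart_dom c)) (chart_overlap c d f)"
    unfolding chart_overlap_def
    using \<open>homeomorphic_map _ _ _\<close> homeomorphic_imp_open_map open_map_def by blast
  then show ?thesis using V openin_trans by blast
qed

text \<open>Smoothness of the group multiplication is stated on \<open>prod_manifold\<close>, whose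
  atlas consists of these product charts.\<close>

lemma is_chart_prod:
  assumes "is_chart V T c" "is_chart V' T' d"
  shows "is_chart (V \<times> V') (prod_topology T T')
    (chart_dom c \<times> chart_dom d, map_prod (chart_map c) (chart_map d))"
proof -
  have im: "map_prod (chart_map c) (chart_map d) ` (chart_dom c \<times> chart_dom d)
    = chart_map c ` chart_dom c \<times> chart_map d ` chart_dom d"
    by (simp add: map_prod_surj_on)
  obtain g g' where
    "homeomorphic_maps (subtopology T (chart_dom c)) (top_of_set (chart_map c ` chart_dom c)) (chart_map c) g"
    "homeomorphic_maps (subtopology T' (chart_dom d)) (top_of_set (chart_map d ` chart_dom d)) (chart_map d) g'"
    using assms unfolding is_chart_def homeomorphic_map_maps by blast
  then have "homeomorphic_map (prod_topology (subtopology T (chart_dom c)) (subtopology T' (chart_dom d)))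
      (prod_topology (top_of_set (chart_map c ` chart_dom c)) (top_of_set (chart_map d ` chart_dom d)))
      (map_prod (chart_map c) (chart_map d))"
    unfolding map_prod_def homeomorphic_map_maps using homeomorphic_maps_prod by blast
  moreover have "openin (prod_topology T T') (chart_dom c \<times> chart_dom d)"
    using assms by (simp add: openin_prod_Times_iff is_chart_def)
  moreover have "openin (prod_topology (top_of_set V) (top_of_set V'))
      (chart_map c ` chart_dom c \<times> chart_map d ` chart_dom d)"
    using assms by (simp add: openin_prod_Times_iff is_chart_def del: prod_topology_subtopology_eu)
  ultimately show ?thesis
    unfolding is_chart_def fst_conv snd_conv im by (simp add: subtopology_Times)
qed

text \<open>\<open>chart_inv\<close> is a choice of preimages, so it splits into components only on
  the image of the chart, where injectivity determines it.\<close>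

lemma chart_inv_prod:
  assumes "is_chart V T c" "is_chart V' T' d"
    and "x \<in> chart_map c ` chart_dom c" "y \<in> chart_map d ` chart_dom d"
  shows "chart_inv (chart_dom c \<times> chart_dom d, map_prod (chart_map c) (chart_map d)) (x, y)
    = (chart_inv c x, chart_inv d y)"
  using is_chart_inv_map[OF is_chart_prod[OF assms(1,2)], of "(chart_inv c x, chart_inv d y)"]
  using assms(3,4) by (simp add: chart_map_inv)

text \<open>On an open set the derivative within \<open>S\<close> is the ordinary derivative, so two
  levels of \<open>Ck_on\<close> can be read as two ordinary differentiations.\<close>

lemma smooth_on_twice_derivable:
  assumes "smooth_on UNIV S f" "open S"
  shows "\<exists>D E. (\<forall>z\<in>S. (f has_derivative D z) (at z)) \<and>
    (\<forall>v. \<forall>z\<in>S. ((\<lambda>z. D z v) has_derivative E z v) (at z))"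
proof -
  define D where "D z = frechet_derivative f (at z)" for z
  have within: "at z within S = at z" if "z \<in> S" for z
    using at_within_open[OF that assms(2)] .
  have C2: "Ck_on (Suc (Suc 0)) UNIV S f" using assms(1) unfolding smooth_on_def by blast
  have "(f has_derivative D z) (at z)" if "z \<in> S" for z
    using C2 that within by (simp add: D_def flip: frechet_derivative_works)
  moreover have "\<exists>E. ((\<lambda>z. D z v) has_derivative E) (at z)" if "z \<in> S" for z v
  proof -
    have "(\<lambda>z. frechet_derivative f (at z within S) v) differentiable (at z within S)"
      using C2 that by simp
    then have "(\<lambda>z. frechet_derivative f (at z within S) v) differentiable (at z)"
      unfolding within[OF that] .
    then obtain E where "((\<lambda>z. frechet_derivative f (at z within S) v) has_derivative E) (at z)"
      unfolding differentiable_def by blast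
    then have "((\<lambda>z. D z v) has_derivative E) (at z)"
      by (rule has_derivative_transform_within_open[OF _ assms(2) that]) (simp add: within D_def)
    then show ?thesis by blast
  qed
  then obtain E where "\<forall>v. \<forall>z\<in>S. ((\<lambda>z. D z v) has_derivative E z v) (at z)" by metis
  ultimately show ?thesis by blast
qed

section \<open>Multiplication and inversion in a chart around the unit element\<close>

locale lie_group_chart =
  fixes G :: "('a, 'm) monoid_scheme" (structure)
    and \<M> :: "('a, 'e::euclidean_space) manifold"
    and c :: "('a, 'e) chart"
  assumes lie_group: "lie_group G \<M>" and model: "mf_model \<M> = UNIV" and unit_chart: "unit_chart G \<M> c"
begin

sublocale group G using lie_group by (simp add: lie_group_def)

abbreviation ci :: "'e \<Rightarrow> 'a" where "ci \<equiv> chart_inv c"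
abbreviation U :: "'e set" where "U \<equiv> chart_map c ` chart_dom c"
abbreviation p :: 'e where "p \<equiv> chart_map c \<one>"

text \<open>\<open>\<mu>\<close> and \<open>\<iota>\<close> are the group operations in coordinates.
  They carry meaning on \<open>U_mult\<close> and \<open>U_inv\<close> only: products and inverses
  may leave the chart domain, where the value of \<open>chart_map c\<close> is arbitrary.\<close>

definition \<mu> :: "'e \<times> 'e \<Rightarrow> 'e" where "\<mu> z = chart_map c (ci (fst z) \<otimes> ci (snd z))"
definition U_mult :: "('e \<times> 'e) set" where "U_mult = {z \<in> U \<times> U. ci (fst z) \<otimes> ci (snd z) \<in> chart_dom c}"
definition \<iota> :: "'e \<Rightarrow> 'e" where "\<iota> x = chart_map c (inv (ci x))"
definition U_inv :: "'e set" where "U_inv = {x \<in> U. inv (ci x) \<in> chart_dom c}"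

lemma atlas: "c \<in> mf_atlas \<M>" and one: "\<one> \<in> chart_dom c"
  using unit_chart by (auto simp: unit_chart_def)

lemma chart: "is_chart UNIV (mf_top \<M>) c"
  using lie_group atlas model by (auto simp: lie_group_def smooth_manifold_def)

lemma dom_carrier: "chart_dom c \<subseteq> carrier G"
proof -
  have "openin (mf_top \<M>) (chart_dom c)" using chart by (simp add: is_chart_def)
  moreover have "topspace (mf_top \<M>) = carrier G" using lie_group by (simp add: lie_group_def)
  ultimately show ?thesis using openin_subset by metis
qed

lemma ci_map [simp]: "g \<in> chart_dom c \<Longrightarrow> ci (chart_map c g) = g"
  using chart by (rule is_chart_inv_map)

lemma map_ci [simp]: "x \<in> U \<Longrightarrow> chart_map c (ci x) = x"
  and ci_dom [simp]: "x \<in> U \<Longrightarrow> ci x \<in> chart_dom c"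
  and ci_carrier [simp]: "x \<in> U \<Longrightarrow> ci x \<in> carrier G"
  using dom_carrier by (auto simp: chart_map_inv)

lemma p_U [simp]: "p \<in> U" and ci_p [simp]: "ci p = \<one>"
  using one by auto

lemma open_U: "open U"
  using chart by (simp add: is_chart_def)

text \<open>\<open>U_mult\<close> is exactly the overlap belonging to the multiplication, the
  product chart \<open>?c\<close> and \<open>c\<close>. The coordinate expression in
  \<open>smooth_map\<close> agrees with \<open>\<mu>\<close> on this open set, so its derivatives
  carry over.\<close>

lemma mu_twice_derivable: "open U_mult" 
  "\<exists>D E. (\<forall>z\<in>U_mult. (\<mu> has_derivative D z) (at z)) \<and>
    (\<forall>v. \<forall>z\<in>U_mult. ((\<lambda>z. D z v) has_derivative E z v) (at z))"
proof -
  let ?c = "(chart_dom c \<times> chart_dom c, map_prod (chart_map c) (chart_map c))"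
  let ?f = "\<lambda>(x, y). x \<otimes> y"
  have smooth: "smooth_map (prod_manifold \<M> \<M>) \<M> ?f" using lie_group by (simp add: lie_group_def)
  have inv: "chart_inv ?c z = (ci (fst z), ci (snd z))" if "z \<in> U \<times> U" for z
    using chart_inv_prod[OF chart chart, of "fst z" "snd z"] that by auto
  have U_mult: "chart_overlap ?c c ?f = U_mult"
  proof (intro equalityI subsetI)
    fix z assume "z \<in> chart_overlap ?c c ?f"
    then show "z \<in> U_mult" by (auto simp: chart_overlap_def U_mult_def)
  next
    fix z assume z: "z \<in> U_mult"
    then have "(ci (fst z), ci (snd z)) \<in> chart_dom ?c \<inter> ?f -` chart_dom c"
      "z = map_prod (chart_map c) (chart_map c) (ci (fst z), ci (snd z))"
      by (auto simp: U_mult_def mem_Times_iff)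
    then show "z \<in> chart_overlap ?c c ?f" unfolding chart_overlap_def by force
  qed
  have "openin (top_of_set (UNIV \<times> UNIV)) (chart_overlap ?c c ?f)"
    using is_chart_prod[OF chart chart]
    by (rule openin_chart_overlap[where T' = "mf_top \<M>"])
      (use chart smooth in \<open>auto simp: is_chart_def smooth_map_def prod_manifold_def\<close>)
  then show W_open: "open U_mult" by (simp add: U_mult)
  have "?c \<in> mf_atlas (prod_manifold \<M> \<M>)"
    using atlas unfolding prod_manifold_def manifold.simps by blast
  moreover have "mf_model (prod_manifold \<M> \<M>) = UNIV"
    using model by (simp add: prod_manifold_def)
  ultimately have "smooth_on UNIV U_mult (chart_map c \<circ> ?f \<circ> chart_inv ?c)"
    using smooth atlas U_mult unfolding smooth_map_def by metis
  then obtain D E where DE: "\<forall>z\<in>U_mult. (chart_map c \<circ> ?f \<circ> chart_inv ?c has_derivative D z) (at z)"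
    "\<forall>v. \<forall>z\<in>U_mult. ((\<lambda>z. D z v) has_derivative E z v) (at z)"
    using smooth_on_twice_derivable W_open by blast
  have "(\<mu> has_derivative D z) (at z)" if "z \<in> U_mult" for z
    using DE(1)[rule_format, OF that]
    by (rule has_derivative_transform_within_open[OF _ W_open that]) (simp add: U_mult_def \<mu>_def inv)
  then show "\<exists>D E. (\<forall>z\<in>U_mult. (\<mu> has_derivative D z) (at z)) \<and>
    (\<forall>v. \<forall>z\<in>U_mult. ((\<lambda>z. D z v) has_derivative E z v) (at z))"
    using DE(2) by blast
qed

lemma iota_differentiable: "open U_inv" "x \<in> U_inv \<Longrightarrow> \<iota> differentiable (at x)"
proof -
  have smooth: "smooth_map \<M> \<M> (\<lambda>x. inv x)" using lie_group by (simp add: lie_group_def)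
  have U: "chart_overlap c c (\<lambda>x. inv x) = U_inv"
  proof (intro equalityI subsetI)
    fix x assume "x \<in> U_inv"
    then have "ci x \<in> chart_dom c \<inter> (\<lambda>x. inv x) -` chart_dom c" "x = chart_map c (ci x)"
      by (auto simp: U_inv_def)
    then show "x \<in> chart_overlap c c (\<lambda>x. inv x)" unfolding chart_overlap_def by blast
  qed (auto simp: chart_overlap_def U_inv_def)
  have "openin (top_of_set UNIV) (chart_overlap c c (\<lambda>x. inv x))"
    using chart by (rule openin_chart_overlap[where T' = "mf_top \<M>"])
      (use chart smooth in \<open>auto simp: is_chart_def smooth_map_def\<close>)
  then show op: "open U_inv" by (simp add: U)
  have "smooth_on UNIV U_inv (chart_map c \<circ> (\<lambda>x. inv x) \<circ> ci)"
    using smooth atlas U model unfolding smooth_map_def by metis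
  moreover have "chart_map c \<circ> (\<lambda>x. inv x) \<circ> ci = \<iota>" by (auto simp: \<iota>_def)
  ultimately show "\<iota> differentiable (at x)" if "x \<in> U_inv"
    using smooth_on_twice_derivable[OF _ op] that unfolding differentiable_def by metis
qed

lemma p_U_inv: "p \<in> U_inv" and \<iota>_p: "\<iota> p = p"
  using one by (auto simp: U_inv_def \<iota>_def)

lemma
  assumes "x \<in> U"
  shows right_unit_dom: "(x, p) \<in> U_mult" and left_unit_dom: "(p, x) \<in> U_mult"
    and mu_right_unit: "\<mu> (x, p) = x" and mu_left_unit: "\<mu> (p, x) = x"
  using assms by (auto simp: U_mult_def \<mu>_def)

lemma
  assumes "x \<in> U_inv"
  shows mu_iota_dom: "(x, \<iota> x) \<in> U_mult" and mu_iota: "\<mu> (x, \<iota> x) = p"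
  using assms one by (auto simp: U_mult_def \<mu>_def \<iota>_def U_inv_def)

lemma U_inv_U: "x \<in> U_inv \<Longrightarrow> x \<in> U" by (simp add: U_inv_def)

section \<open>The derivative of Ad is the Lie bracket\<close>

text \<open>Conjugation in coordinates is \<open>\<mu> (\<mu> (x, y), \<iota> x)\<close>. With
  \<open>D\<close> the first derivative of \<open>\<mu>\<close> and \<open>E\<close> the second one
  at \<open>(p, p)\<close>, both \<open>Ad\<close> and \<open>lie_br\<close> become expressions in
  \<open>D\<close> and \<open>E\<close>, and these are compared.\<close>

lemma Ad_has_derivative:
  "((\<lambda>x. Ad G c (ci x) X) has_derivative (\<lambda>Y. lie_br G c Y X)) (at p)"
proof -
  obtain D E' where D: "\<And>z. z \<in> U_mult \<Longrightarrow> (\<mu> has_derivative D z) (at z)"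
    and E': "\<And>v z. z \<in> U_mult \<Longrightarrow> ((\<lambda>z. D z v) has_derivative E' z v) (at z)"
    using mu_twice_derivable(2) by blast
  define E where "E = E' (p, p)"
  have pW: "(p, p) \<in> U_mult" using right_unit_dom p_U by blast
  have E: "((\<lambda>z. D z v) has_derivative E v) (at (p, p))" for v
    unfolding E_def using E' pW by blast
  have linD: "linear (D z)" if "z \<in> U_mult" for z using D[OF that] has_derivative_linear by blast
  have linE: "linear (E v)" for v using E has_derivative_linear by blast
  have sym: "E v w = E w v" for v w
    using symmetric_second_derivative[OF mu_twice_derivable(1) pW D E E] .
  have right: "((\<lambda>x. (x, p)) has_derivative (\<lambda>h. (h, 0))) (at x)"
    and left: "((\<lambda>y. (x, y)) has_derivative (\<lambda>h. (0, h))) (at y)" for x y :: 'e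
    by (auto intro!: derivative_eq_intros)
  \<comment> \<open>Differentiates the right unit law. It is proved at every \<open>x\<close> in
    \<open>U\<close>, not only at \<open>p\<close>, because it is differentiated once more in
    \<open>x\<close> for \<open>E_right_0\<close>.\<close>
  have D_right: "D (x, p) (h, 0) = h" if "x \<in> U" for x h
  proof -
    have "((\<lambda>x. \<mu> (x, p)) has_derivative (\<lambda>h. D (x, p) (h, 0))) (at x)"
      using diff_chain_at[OF right D[OF right_unit_dom[OF that]]] by (simp add: o_def)
    then have "((\<lambda>x. x) has_derivative (\<lambda>h. D (x, p) (h, 0))) (at x)"
      by (rule has_derivative_transform_within_open[OF _ open_U that]) (rule mu_right_unit)
    then show ?thesis using has_derivative_unique[OF _ has_derivative_ident] by metis
  qed
  have D_left: "D (p, p) (0, h) = h" for h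
  proof -
    have "((\<lambda>x. \<mu> (p, x)) has_derivative (\<lambda>h. D (p, p) (0, h))) (at p)"
      using diff_chain_at[OF left D[OF pW]] by (simp add: o_def)
    then have "((\<lambda>x. x) has_derivative (\<lambda>h. D (p, p) (0, h))) (at p)"
      by (rule has_derivative_transform_within_open[OF _ open_U p_U]) (rule mu_left_unit)
    then show ?thesis using has_derivative_unique[OF _ has_derivative_ident] by metis
  qed
  have E_right: "((\<lambda>x. D (x, p) v) has_derivative (\<lambda>h. E v (h, 0))) (at p)" for v
    using diff_chain_at[OF right E] by (simp add: o_def)
  have E_right_0: "E (v, 0) (h, 0) = 0" for v h
  proof -
    have "((\<lambda>x. v) has_derivative (\<lambda>h. E (v, 0) (h, 0))) (at p)"
      using E_right by (rule has_derivative_transform_within_open[OF _ open_U p_U]) (rule D_right)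
    then show ?thesis using has_derivative_unique[OF _ has_derivative_const] by metis
  qed
  \<comment> \<open>The left-invariant field is the partial derivative of \<open>\<mu>\<close> in
    its second variable, so its own derivative, and with it the bracket, is a mixed second
    derivative of \<open>\<mu>\<close>.\<close>
  have left_field: "left_field G c Y x = D (x, p) (0, Y)" if "x \<in> U" for x Y
  proof -
    have "((\<lambda>y. \<mu> (x, y)) has_derivative (\<lambda>h. D (x, p) (0, h))) (at p)"
      using diff_chain_at[OF left D[OF right_unit_dom[OF that]]] by (simp add: o_def)
    then show ?thesis
      unfolding left_field_def \<mu>_def fst_conv snd_conv by (simp flip: frechet_derivative_at)
  qed
  have field_deriv: "(left_field G c Y has_derivative (\<lambda>h. E (0, Y) (h, 0))) (at p)" for Y
    using E_right by (rule has_derivative_transform_within_open[OF _ open_U p_U]) (simp add: left_field)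
  have br: "lie_br G c Y X = E (0, X) (Y, 0) - E (0, Y) (X, 0)" for X Y
    unfolding lie_br_def frechet_derivative_at[OF field_deriv, symmetric] ..
  obtain \<iota>' where \<iota>: "(\<iota> has_derivative \<iota>') (at p)"
    using iota_differentiable(2)[OF p_U_inv] unfolding differentiable_def by blast
  have pair: "((\<lambda>x. (x, \<iota> x)) has_derivative (\<lambda>h. (h, \<iota>' h))) (at p)"
    using \<iota> by (auto intro!: derivative_eq_intros)
  \<comment> \<open>Differentiates the identity \<open>\<mu> (x, \<iota> x) = p\<close> at
    \<open>p\<close>, where both partial derivatives of \<open>\<mu>\<close> are the
    identity.\<close>
  have \<iota>': "\<iota>' h = - h" for h
  proof -
    have "((\<lambda>x. \<mu> (x, \<iota> x)) has_derivative (\<lambda>h. D (p, p) (h, \<iota>' h))) (at p)"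
      using diff_chain_at[OF pair] D[OF pW] by (simp add: o_def \<iota>_p)
    then have "((\<lambda>x. p) has_derivative (\<lambda>h. D (p, p) (h, \<iota>' h))) (at p)"
      by (rule has_derivative_transform_within_open[OF _ iota_differentiable(1) p_U_inv]) (rule mu_iota)
    from has_derivative_unique[OF this has_derivative_const] have "D (p, p) (h, \<iota>' h) = 0"
      by (rule fun_cong)
    moreover have "D (p, p) (h, \<iota>' h) = D (p, p) (h, 0) + D (p, p) (0, \<iota>' h)"
      using linear_add[OF linD[OF pW], of "(h, 0)" "(0, \<iota>' h)"] by simp
    ultimately show ?thesis using D_right[OF p_U] D_left by (simp add: eq_neg_iff_add_eq_0 add.commute)
  qed
  have Ad: "Ad G c (ci x) X = D (x, \<iota> x) (D (x, p) (0, X), 0)" if x: "x \<in> U_inv" for x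
  proof -
    note xU = U_inv_U[OF x]
    have 1: "((\<lambda>y. \<mu> (x, y)) has_derivative (\<lambda>h. D (x, p) (0, h))) (at p)"
      using diff_chain_at[OF left D[OF right_unit_dom[OF xU]]] by (simp add: o_def)
    then have 2: "((\<lambda>y. (\<mu> (x, y), \<iota> x)) has_derivative (\<lambda>h. (D (x, p) (0, h), 0))) (at p)"
      by (auto intro!: derivative_eq_intros)
    have 3: "((\<lambda>y. \<mu> (\<mu> (x, y), \<iota> x)) has_derivative (\<lambda>h. D (x, \<iota> x) (D (x, p) (0, h), 0))) (at p)"
      using diff_chain_at[OF 2] D[OF mu_iota_dom[OF x]] by (simp add: o_def mu_right_unit[OF xU])
    have cont: "isCont (\<lambda>y. (x, y)) p" by (intro continuous_intros)
    \<comment> \<open>For \<open>y\<close> in \<open>T\<close> the product of \<open>ci x\<close>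
      and \<open>ci y\<close> stays in the chart domain, so \<open>ci\<close> undoes the inner chart
      map and the nested \<open>\<mu>\<close> is the chart value of the conjugate.\<close>
    obtain T where T: "open T" "p \<in> T" "\<And>y. y \<in> T \<Longrightarrow> (x, y) \<in> U_mult"
      using cont mu_twice_derivable(1) right_unit_dom[OF xU] unfolding continuous_at_open by metis
    have 4: "\<mu> (\<mu> (x, y), \<iota> x) = chart_map c (ci x \<otimes> ci y \<otimes> inv (ci x))" if "y \<in> T" for y
      using T(3)[OF that] x by (auto simp: \<mu>_def \<iota>_def U_mult_def U_inv_def)
    have "((\<lambda>y. chart_map c (ci x \<otimes> ci y \<otimes> inv (ci x))) has_derivative
        (\<lambda>h. D (x, \<iota> x) (D (x, p) (0, h), 0))) (at p)"
      by (rule has_derivative_transform_within_open[OF 3 T(1,2) 4])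
    then show ?thesis unfolding Ad_def by (simp flip: frechet_derivative_at)
  qed
  have \<beta>: "((\<lambda>x. (D (x, p) (0, X), 0)) has_derivative (\<lambda>h. (E (0, X) (h, 0), 0))) (at p)"
    using E_right by (auto intro!: derivative_eq_intros)
  \<comment> \<open>Product rule with base point \<open>(x, \<iota> x)\<close> and argument
    \<open>(D (x, p) (0, X), 0)\<close>, both moving with \<open>x\<close>.\<close>
  have "((\<lambda>x. D (x, \<iota> x) (D (x, p) (0, X), 0)) has_derivative
     (\<lambda>h. E (D (p, p) (0, X), 0) (h, \<iota>' h) + D (p, \<iota> p) (E (0, X) (h, 0), 0))) (at p)"
    by (rule has_derivative_family_apply[OF mu_twice_derivable(1) _ linD _ pair \<beta>])
      (use E pW in \<open>auto simp: \<iota>_p\<close>)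
  moreover have "E (D (p, p) (0, X), 0) (h, \<iota>' h) + D (p, \<iota> p) (E (0, X) (h, 0), 0) = lie_br G c h X" for h
  proof -
    \<comment> \<open>Of these two terms the first vanishes by \<open>E_right_0\<close>. The second
      becomes \<open>E (0, h) (X, 0)\<close> by symmetry, which is the subtracted term of the
      bracket; the added term comes from the moving argument.\<close>
    have "E (X, 0) (h, - h) = E (X, 0) (h, 0) - E (X, 0) (0, h)"
      using linear_diff[OF linE, of "(X, 0)" "(h, 0)" "(0, h)"] by simp
    then show ?thesis
      by (simp add: \<iota>_p \<iota>' D_left D_right[OF p_U] E_right_0 br sym[of "(X, 0)" "(0, h)"])
  qed
  ultimately have "((\<lambda>x. D (x, \<iota> x) (D (x, p) (0, X), 0)) has_derivative (\<lambda>h. lie_br G c h X)) (at p)"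
    by simp
  then show ?thesis
    by (rule has_derivative_transform_within_open[OF _ iota_differentiable(1) p_U_inv]) (simp add: Ad)
qed

lemma Ad_infinitesimal_eq_lie_br: "Ad_infinitesimal G c Y X = lie_br G c Y X"
  unfolding Ad_infinitesimal_def using frechet_derivative_at[OF Ad_has_derivative] by metis

lemma lie_br_skew: "lie_br G c X Y = - lie_br G c Y X"
  by (simp add: lie_br_def)

lemma linear_lie_br_left: "linear (\<lambda>Y. lie_br G c Y X)"
  using Ad_has_derivative has_derivative_linear by blast

lemma linear_lie_br_right: "linear (lie_br G c Y)"
proof -
  have "lie_br G c Y = (\<lambda>X. - lie_br G c X Y)" using lie_br_skew by blast
  then show ?thesis using linear_compose_neg[OF linear_lie_br_left] by simp
qed

end

section \<open>Curves in subgroups and the isotropy action\<close>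

text \<open>Let \<open>z\<close> be the component of \<open>y\<close> orthogonal to
  \<open>h\<close>. The inner product of the curve with \<open>z\<close> is constantly zero near
  \<open>x\<close>, so its derivative gives that \<open>y\<close> is orthogonal to \<open>z\<close>,
  whence \<open>z\<close> is zero.\<close>

lemma derivative_in_subspace:
  fixes \<phi> :: "real \<Rightarrow> 'e::euclidean_space"
  assumes "(\<phi> has_derivative (\<lambda>t. t *\<^sub>R y)) (at x)" "open T" "x \<in> T"
    and "subspace h" "\<And>t. t \<in> T \<Longrightarrow> \<phi> t \<in> h"
  shows "y \<in> h"
proof -
  obtain u z where u: "u \<in> span h" and z: "\<And>w. w \<in> span h \<Longrightarrow> orthogonal z w" and y: "y = u + z"
    using orthogonal_subspace_decomp_exists by metis
  have span: "span h = h" using assms(4) by simp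
  have perp: "\<phi> t \<bullet> z = 0" if "t \<in> T" for t
    using z[of "\<phi> t"] assms(5)[OF that] by (simp add: span orthogonal_def inner_commute)
  have "((\<lambda>t. \<phi> t \<bullet> z) has_derivative (\<lambda>t. (t *\<^sub>R y) \<bullet> z)) (at x)"
    using assms(1) by (rule has_derivative_inner_left)
  then have "((\<lambda>t. 0) has_derivative (\<lambda>t. (t *\<^sub>R y) \<bullet> z)) (at x)"
    by (rule has_derivative_transform_within_open[OF _ assms(2,3)]) (rule perp)
  then have "(1 *\<^sub>R y) \<bullet> z = 0"
    using has_derivative_unique[OF _ has_derivative_const] by metis
  then have "z \<bullet> z = 0"
    using z[OF u] by (simp add: y inner_add_left inner_add_right orthogonal_def inner_commute)
  then show ?thesis using u by (simp add: y span)
qed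

context lie_group_chart
begin

text \<open>The curve plays the part of a one-parameter subgroup: it is a straight segment in a
  chart of the intrinsic manifold structure of \<open>N\<close>, carried into \<open>G\<close> by
  the inclusion. Its direction \<open>v\<close> is chosen as a preimage of \<open>Y\<close> under
  the differential of the inclusion.\<close>

lemma subgroup_tangent_curve:
  assumes N: "connected_lie_subgroup G \<M> c N s" and "Y \<in> s"
  obtains \<gamma> T where "(\<gamma> has_derivative (\<lambda>t. t *\<^sub>R Y)) (at 0)" "\<gamma> 0 = p" "open T" "0 \<in> T"
    "\<And>t. t \<in> T \<Longrightarrow> ci (\<gamma> t) \<in> N"
proof -
  obtain M' :: "('a, 'e) manifold" where lg: "lie_group (G\<lparr>carrier := N\<rparr>) M'"
    and imm: "smooth_immersion M' \<M> (\<lambda>x. x)"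
    and tangent: "\<And>d. unit_chart G M' d \<Longrightarrow> chart_differential d c (\<lambda>x. x) \<one> ` mf_model M' = s"
    and sub: "subgroup N G"
    using N unfolding connected_lie_subgroup_def by blast
  have man: "smooth_manifold M'" and top: "topspace (mf_top M') = N"
    using lg by (auto simp: lie_group_def)
  then obtain d where d: "d \<in> mf_atlas M'" "\<one> \<in> chart_dom d"
    using subgroup.one_closed[OF sub] unfolding smooth_manifold_def by blast
  define V where "V = mf_model M'"
  define S where "S = chart_overlap d c (\<lambda>x. x)"
  define q where "q = chart_map d \<one>"
  define f where "f = chart_map c \<circ> (\<lambda>x. x) \<circ> chart_inv d"
  define f' where "f' = frechet_derivative f (at q within S)"
  have V: "subspace V" and chart_d: "is_chart V (mf_top M') d"
    using man d by (auto simp: smooth_manifold_def V_def)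
  have dom_d: "chart_dom d \<subseteq> N"
    using chart_d openin_subset top unfolding is_chart_def by metis
  have smooth: "smooth_map M' \<M> (\<lambda>x. x)" using imm by (simp add: smooth_immersion_def)
  have "openin (top_of_set V) S"
    unfolding S_def using chart_d
    by (rule openin_chart_overlap[where T' = "mf_top \<M>"])
      (use chart smooth in \<open>auto simp: is_chart_def smooth_map_def\<close>)
  then obtain Q where Q: "open Q" "S = V \<inter> Q" by (auto simp: openin_open)
  have qS: "q \<in> S" using d one by (auto simp: q_def S_def chart_overlap_def)
  have "smooth_on V S f"
    using smooth atlas d unfolding smooth_map_def S_def f_def V_def by blast
  then have "Ck_on (Suc 0) V S f" unfolding smooth_on_def by blast
  then have f': "(f has_derivative f') (at q within S)"
    using qS unfolding f'_def by (simp flip: frechet_derivative_works)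
  have "f' ` V = s"
    using tangent[of d] d unfolding unit_chart_def chart_differential_def f'_def f_def q_def S_def V_def by blast
  then obtain v where v: "v \<in> V" "f' v = Y" using \<open>Y \<in> s\<close> by blast
  \<comment> \<open>\<open>S\<close> is open only relative to \<open>V\<close>. As \<open>q\<close>
    and \<open>v\<close> lie in \<open>V\<close>, the segment stays in \<open>V\<close>, and
    membership in the ambient open set \<open>Q\<close> is the only condition on
    \<open>t\<close>.\<close>
  define T where "T = (\<lambda>t. q + t *\<^sub>R v) -` Q"
  have "open T" unfolding T_def by (intro open_vimage Q(1) continuous_intros)
  moreover have "0 \<in> T" using Q qS by (simp add: T_def)
  ultimately have T: "open T" "0 \<in> T" .
  have inS: "q + t *\<^sub>R v \<in> S" if "t \<in> T" for t
    using that qS v V Q by (auto simp: T_def intro: subspace_add subspace_scale)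
  show thesis
  proof
    interpret f': bounded_linear f' using f' by (rule has_derivative_bounded_linear)
    \<comment> \<open>\<open>V\<close> may be a proper subspace, so \<open>f\<close> has a
      derivative only within \<open>S\<close>. The chain rule is therefore applied within
      \<open>T\<close>; since \<open>T\<close> is open, the result is an ordinary
      derivative.\<close>
    have "((\<lambda>t. q + t *\<^sub>R v) has_derivative (\<lambda>t. t *\<^sub>R v)) (at 0 within T)"
      by (auto intro!: derivative_eq_intros)
    moreover have "(f has_derivative f') (at (q + 0 *\<^sub>R v) within (\<lambda>t. q + t *\<^sub>R v) ` T)"
      unfolding scaleR_zero_left add_0_right by (rule has_derivative_subset[OF f']) (use inS in auto)
    ultimately have "((\<lambda>t. f (q + t *\<^sub>R v)) has_derivative (\<lambda>t. f' (t *\<^sub>R v))) (at 0 within T)"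
      by (rule has_derivative_in_compose)
    then show "((\<lambda>t. f (q + t *\<^sub>R v)) has_derivative (\<lambda>t. t *\<^sub>R Y)) (at 0)"
      unfolding at_within_open[OF T(2,1)] f'.scaleR v(2) .
    show "f (q + 0 *\<^sub>R v) = p"
      using is_chart_inv_map[OF chart_d] d by (simp add: f_def q_def)
    show "ci (f (q + t *\<^sub>R v)) \<in> N" if "t \<in> T" for t
    proof -
      from inS[OF that] obtain g where g: "g \<in> chart_dom d" "g \<in> chart_dom c" "q + t *\<^sub>R v = chart_map d g"
        by (auto simp: S_def chart_overlap_def)
      then show ?thesis
        using is_chart_inv_map[OF chart_d] dom_d by (auto simp: f_def)
    qed
  qed (use T in auto)
qed

lemma group_acts_trivially_bracket:
  assumes N: "connected_lie_subgroup G \<M> c N s" and h: "subspace h"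
    and triv: "group_acts_trivially G c h N" and "Y \<in> s"
  shows "lie_br G c Y X \<in> h"
proof -
  obtain \<gamma> T where \<gamma>: "(\<gamma> has_derivative (\<lambda>t. t *\<^sub>R Y)) (at 0)" "\<gamma> 0 = p" and T: "open T" "0 \<in> T"
    and N: "\<And>t. t \<in> T \<Longrightarrow> ci (\<gamma> t) \<in> N"
    using subgroup_tangent_curve[OF N \<open>Y \<in> s\<close>] by metis
  have Ad_h: "Ad G c g X - X \<in> h" if "g \<in> N" for g
  proof -
    have "quot_map h (Ad G c g) (X +o h) = X +o h"
      using triv that by (auto simp: group_acts_trivially_def tangent_quotient_def)
    \<comment> \<open>\<open>X\<close> represents its own coset because \<open>h\<close> contains
      zero, so \<open>Ad G c g X\<close> lies in the image coset, which is \<open>X +o h\<close> by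
      triviality of the action.\<close>
    moreover have "X \<in> X +o h" "Ad G c g X \<in> Ad G c g X +o h"
      using subspace_0[OF h] by (auto simp: elt_set_plus_def)
    ultimately have "Ad G c g X \<in> X +o h" unfolding quot_map_def by blast
    then show ?thesis by (auto simp: elt_set_plus_def)
  qed
  have "((\<lambda>t. Ad G c (ci (\<gamma> t)) X) has_derivative (\<lambda>t. lie_br G c (t *\<^sub>R Y) X)) (at 0)"
    using diff_chain_at[OF \<gamma>(1), of "\<lambda>x. Ad G c (ci x) X" "\<lambda>Y. lie_br G c Y X"] Ad_has_derivative by (simp add: o_def \<gamma>(2))
  then have "((\<lambda>t. Ad G c (ci (\<gamma> t)) X - X) has_derivative (\<lambda>t. t *\<^sub>R lie_br G c Y X)) (at 0)"
    by (auto intro!: derivative_eq_intros simp: linear_scale[OF linear_lie_br_left])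
  then show ?thesis
    by (rule derivative_in_subspace[OF _ T h]) (simp add: Ad_h N)
qed

text \<open>The infinitesimal action is the bracket by \<open>Ad_infinitesimal_eq_lie_br\<close>.
  Every \<open>X\<close> represents some coset, and a coset is the zero class exactly if its
  representative lies in \<open>h\<close>.\<close>

lemma algebra_acts_trivially_iff:
  assumes h: "subspace h"
  shows "algebra_acts_trivially G c h n \<longleftrightarrow> (\<forall>Y\<in>n. \<forall>X. lie_br G c Y X \<in> h)"
proof -
  have coset: "X +o h = h \<longleftrightarrow> X \<in> h" for X
  proof
    assume "X +o h = h"
    moreover have "X + 0 \<in> X +o h" using subspace_0[OF h] unfolding elt_set_plus_def by blast
    ultimately show "X \<in> h" by simp
  next
    assume X: "X \<in> h"
    show "X +o h = h"
    proof (intro equalityI subsetI)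
      fix y assume "y \<in> h"
      then have "y = X + (y - X)" "y - X \<in> h" using X h by (auto intro: subspace_diff)
      then show "y \<in> X +o h" unfolding elt_set_plus_def by blast
    qed (use X h in \<open>auto simp: elt_set_plus_def intro: subspace_add\<close>)
  qed
  show ?thesis
  proof (intro iffI ballI allI)
    fix Y X assume "algebra_acts_trivially G c h n" "Y \<in> n"
    then have "(\<Union>Z\<in>X +o h. lie_br G c Y Z +o h) = h"
      unfolding algebra_acts_trivially_def tangent_quotient_def quot_map_def Ad_infinitesimal_eq_lie_br by blast
    moreover have "X + 0 \<in> X +o h" "lie_br G c Y X + 0 \<in> lie_br G c Y X +o h"
      using subspace_0[OF h] unfolding elt_set_plus_def by blast+
    ultimately show "lie_br G c Y X \<in> h" by auto
  next
    assume br: "\<forall>Y\<in>n. \<forall>X. lie_br G c Y X \<in> h"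
    have "(\<Union>Z\<in>X +o h. lie_br G c Y Z +o h) = h" if "Y \<in> n" for X Y
    proof -
      have "lie_br G c Y Z +o h = h" for Z
        using br that coset by blast
      moreover
      have "X + 0 \<in> X +o h" using subspace_0[OF h] unfolding elt_set_plus_def by blast
      ultimately show ?thesis by auto
    qed
    then show "algebra_acts_trivially G c h n"
      unfolding algebra_acts_trivially_def tangent_quotient_def quot_map_def Ad_infinitesimal_eq_lie_br by blast
  qed
qed

end

section \<open>The Cartan involution and the two implications\<close>

text \<open>\<open>\<theta>\<close> is -1 on \<open>a\<close>, so bracketing
  \<open>\<theta> x\<close> with \<open>y\<close> in \<open>a\<close> gives minus the image under
  \<open>\<theta>\<close> of the bracket of \<open>x\<close> and \<open>y\<close>, which is
  zero.\<close>

lemma centralizer_cartan_involution: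
  assumes \<theta>: "cartan_involution br \<theta>" and a: "a \<subseteq> cartan_p \<theta>"
    and br: "\<And>x. linear (br x)" and x: "x \<in> centralizer br a"
  shows "\<theta> x \<in> centralizer br a"
  unfolding centralizer_def
proof (intro CollectI ballI)
  fix y assume y: "y \<in> a"
  have lin: "linear \<theta>" and hom: "\<theta> (br x y) = br (\<theta> x) (\<theta> y)"
    using \<theta> by (auto simp: cartan_involution_def)
  have "\<theta> y = - y" using a y by (auto simp: cartan_p_def)
  then have "br (\<theta> x) y = - \<theta> (br x y)" by (simp add: hom linear_neg[OF br])
  also have "\<dots> = 0" using x y lin by (simp add: centralizer_def linear_0)
  finally show "br (\<theta> x) y = 0" .
qed

theorem theorem1:
  fixes G :: "'a monoid"
    and \<M> :: "('a, 'e::euclidean_space) manifold"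
    and c :: "('a, 'e) chart"
    and \<theta> :: "'e \<Rightarrow> 'e"
    and h m a n_minus n_plus :: "'e set"
    and H M A N_minus :: "'a set"
  assumes "lie_group G \<M>" and "mf_model \<M> = UNIV" and "unit_chart G \<M> c"
    and "connected_space (mf_top \<M>)" and "\<not> compact_space (mf_top \<M>)"
    and "lie_semisimple (lie_br G c)"
    and "cartan_involution (lie_br G c) \<theta>"
    and "proper_parabolic_subalgebra (lie_br G c) h"
    and "langlands_decomposition (lie_br G c) \<theta> h m a n_minus"
    and "n_plus = \<theta> ` n_minus"
    and "direct_sum3 UNIV n_plus (a + m) n_minus"
    and "connected_lie_subgroup G \<M> c M m"
    and "connected_lie_subgroup G \<M> c A a"
    and "connected_lie_subgroup G \<M> c N_minus n_minus"
    and "connected_lie_subgroup G \<M> c H h"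
    and "H = M <#>\<^bsub>G\<^esub> A <#>\<^bsub>G\<^esub> N_minus"
    and "H = identity_component G \<M> (parabolic_subgroup G c h)"
  shows "(group_acts_trivially G c h N_minus \<longrightarrow> bracket_span (lie_br G c) n_plus n_minus \<subseteq> a + m) \<and>
         (bracket_span (lie_br G c) n_plus n_minus \<subseteq> a + m \<longrightarrow> algebra_acts_trivially G c h n_minus)"
proof -
  interpret lie_group_chart G \<M> c using assms(1-3) by unfold_locales
  let ?br = "lie_br G c"
  have h: "subspace h" and h_br: "\<And>x y. x \<in> h \<Longrightarrow> y \<in> h \<Longrightarrow> ?br x y \<in> h"
    using assms(8) by (auto simp: proper_parabolic_subalgebra_def lie_subalgebra_def)
  have h_sum: "h = (a + m) + n_minus" and a_p: "a \<subseteq> cartan_p \<theta>" and cent: "a + m = centralizer ?br a"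
    using assms(9) by (auto simp: langlands_decomposition_def direct_sum3_def add.commute)
  have l: "subspace (a + m)" and n: "subspace n_minus"
    and UNIV_sum: "UNIV = n_plus + (a + m) + n_minus"
    and direct: "\<And>x y z. x \<in> n_plus \<Longrightarrow> y \<in> a + m \<Longrightarrow> z \<in> n_minus \<Longrightarrow> x + y + z = 0 \<Longrightarrow> x = 0 \<and> y = 0 \<and> z = 0"
    using assms(11) unfolding direct_sum3_def by blast+
  have \<theta>: "linear \<theta>" "\<And>x y. \<theta> (?br x y) = ?br (\<theta> x) (\<theta> y)" "\<And>x. \<theta> (\<theta> x) = x"
    using assms(7) by (auto simp: cartan_involution_def)
  have \<theta>_l: "\<theta> x \<in> a + m" if "x \<in> a + m" for x
    using centralizer_cartan_involution[OF assms(7) a_p linear_lie_br_right] that unfolding cent .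
  \<comment> \<open>The intersection of \<open>h\<close> with its image under
    \<open>\<theta>\<close>: decompose both \<open>w\<close> and \<open>\<theta> w\<close> along
    \<open>h\<close>, apply \<open>\<theta>\<close> to the second decomposition and compare the two
    expressions for \<open>w\<close>.\<close>
  have inter: "w \<in> a + m" if w: "w \<in> h" "\<theta> w \<in> h" for w
  proof -
    obtain x y where xy: "x \<in> a + m" "y \<in> n_minus" "w = x + y"
      using w(1) unfolding h_sum by (rule set_plus_elim)
    obtain x' y' where xy': "x' \<in> a + m" "y' \<in> n_minus" "\<theta> w = x' + y'"
      using w(2) unfolding h_sum by (rule set_plus_elim)
    have "w = \<theta> x' + \<theta> y'" using \<theta>(3)[of w] xy' linear_add[OF \<theta>(1)] by simp
    \<comment> \<open>The comparison is regrouped as a vanishing sum with one term in each summand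
      of the Bruhat decomposition, so the \<open>n_minus\<close> component of \<open>w\<close> is
      zero.\<close>
    then have "\<theta> y' + (\<theta> x' - x) + - y = 0" using xy(3) by (simp add: algebra_simps)
    moreover have "\<theta> y' \<in> n_plus" using xy' assms(10) by blast
    moreover have "\<theta> x' - x \<in> a + m" using \<theta>_l xy(1) xy'(1) l by (simp add: subspace_diff)
    moreover have "- y \<in> n_minus" using xy(2) n by (simp add: subspace_neg)
    ultimately have "- y = 0" using direct by blast
    then show ?thesis using xy by simp
  qed
  have l_h: "a + m \<subseteq> h"
    using subspace_0[OF n] unfolding h_sum by (metis add.right_neutral set_plus_intro subsetI)
  have n_h: "n_minus \<subseteq> h"
    using subspace_0[OF l] unfolding h_sum by (metis add.left_neutral set_plus_intro subsetI)
  show ?thesis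
  proof (intro conjI impI)
    assume triv: "group_acts_trivially G c h N_minus"
    have br_h: "?br y z \<in> h" if "y \<in> n_minus" for y z
      using group_acts_trivially_bracket[OF assms(14) h triv that] .
    have "?br x y \<in> a + m" if x: "x \<in> n_plus" and y: "y \<in> n_minus" for x y
    proof (rule inter)
      show "?br x y \<in> h" using br_h[OF y] h lie_br_skew[of x y] by (simp add: subspace_neg)
      \<comment> \<open>As \<open>x\<close> is the image of some \<open>x0\<close> in
        \<open>n_minus\<close>, applying \<open>\<theta>\<close> gives the bracket of
        \<open>x0\<close> with \<open>\<theta> y\<close>, to which \<open>br_h\<close> applies
        again.\<close>
      show "\<theta> (?br x y) \<in> h" using x br_h \<theta>(2,3) assms(10) by auto
    qed
    then show "bracket_span ?br n_plus n_minus \<subseteq> a + m"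
      unfolding bracket_span_def using l by (intro span_minimal) auto
  next
    assume sub: "bracket_span ?br n_plus n_minus \<subseteq> a + m"
    have "?br Y X \<in> h" if Y: "Y \<in> n_minus" for Y X
    proof -
      have "X \<in> n_plus + (a + m) + n_minus" using UNIV_sum by blast
      \<comment> \<open>The last two Bruhat summands together form \<open>h\<close>. The part
        \<open>z\<close> is handled by \<open>h\<close> being a subalgebra, and the part
        \<open>x\<close> by the assumption on brackets together with skew-symmetry.\<close>
      then obtain x z where x: "x \<in> n_plus" and z: "z \<in> h" and X: "X = x + z"
        unfolding add.assoc[of n_plus] h_sum by (rule set_plus_elim)
      have "?br x Y \<in> a + m"
        using sub x Y unfolding bracket_span_def by (blast intro: span_base)
      then have "?br Y x \<in> h" using l_h h lie_br_skew[of Y x] by (auto intro: subspace_neg)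
      moreover have "?br Y z \<in> h" using h_br Y n_h z by blast
      ultimately show ?thesis
        using h by (simp add: X linear_add[OF linear_lie_br_right] subspace_add)
    qed
    then show "algebra_acts_trivially G c h n_minus"
      using algebra_acts_trivially_iff[OF h] by blast
  qed
qed

end
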